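(* For any (finite, simple) graph $H$ without isolated vertices the following hold: (i) $\frac{AR_{loc}(H)^{1/3}}{2} \leq AR_{FF}(H) \leq AR_o(H) \leq AR_s(H) \leq \binom{AR_{loc}(H)}{2}$; (ii) $AR_s(H) \geq \frac{1}{2} AR_{loc}(H)\,\delta(H)$, where $\delta(H)$ denotes the minimum degree of $H$.
   Context: All graphs are finite and simple. Edges are colored with natural numbers $1,2,\ldots$. An edge-coloring is proper if adjacent edges receive distinct colors. A graph with an edge-coloring is rainbow if all its edges have distinct colors; a copy of $H$ is a (not necessarily induced) subgraph isomorphic to $H$. The size anti-Ramsey number $AR_s(H)$ is the smallest number of edges in a graph $G$ such that every proper edge-coloring of $G$ contains a rainbow copy of $H$. The local anti-Ramsey number $AR_{loc}(H)$ is the smallest $n$ such that every proper edge-coloring of the complete graph $K_n$ contains a rainbow copy of $H$. The online anti-Ramsey number $AR_o(H)$ is defined by a game between Builder and Painter: Builder creates vertices and edges, one edge at a time (the graph stays simple); immediately after each edge is built, Painter irrevocably colors it so that the coloring stays proper. Both players have complete information. $AR_o(H)$ is the smallest $t$ such that Builder has a strategy which, against every Painter, guarantees a rainbow copy of $H$ after at most $t$ edges have been built and colored. The First-Fit anti-Ramsey number $AR_{FF}(H)$ is defined in the same way except that Painter must use the First-Fit strategy: each new edge gets the smallest color in $\{1,2,\ldots\}$ not used on an adjacent edge already presented. *)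

theory Defs
  imports Complex_Main
begin

type_synonym 'a graph = "'a set \<times> 'a set set"

abbreviation verts :: "'a graph \<Rightarrow> 'a set" where
  "verts G \<equiv> fst G"

abbreviation edges :: "'a graph \<Rightarrow> 'a set set" where
  "edges G \<equiv> snd G"

definition simple_graph :: "'a graph \<Rightarrow> bool" where
  "simple_graph G \<longleftrightarrow> finite (verts G) \<and> (\<forall>e\<in>edges G. e \<subseteq> verts G \<and> card e = 2)"

definition no_isolated_vertices :: "'a graph \<Rightarrow> bool" where
  "no_isolated_vertices G \<longleftrightarrow> (\<forall>v\<in>verts G. \<exists>e\<in>edges G. v \<in> e)"

definition degree :: "'a graph \<Rightarrow> 'a \<Rightarrow> nat" where
  "degree G v = card {e \<in> edges G. v \<in> e}"

definition min_degree :: "'a graph \<Rightarrow> nat" where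
  "min_degree G = Min (degree G ` verts G)"

definition complete_graph :: "nat \<Rightarrow> nat graph" where
  "complete_graph n = ({..<n}, {e. e \<subseteq> {..<n} \<and> card e = 2})"

definition subgraph :: "'a graph \<Rightarrow> 'a graph \<Rightarrow> bool" where
  "subgraph F G \<longleftrightarrow> simple_graph F \<and> verts F \<subseteq> verts G \<and> edges F \<subseteq> edges G"

definition isomorphic :: "'a graph \<Rightarrow> 'b graph \<Rightarrow> bool" where
  "isomorphic F G \<longleftrightarrow>
     (\<exists>f. bij_betw f (verts F) (verts G) \<and> edges G = (\<lambda>e. f ` e) ` edges F)"

definition proper_coloring :: "'a graph \<Rightarrow> ('a set \<Rightarrow> nat) \<Rightarrow> bool" where
  "proper_coloring G c \<longleftrightarrow>
     (\<forall>e\<in>edges G. 1 \<le> c e) \<and>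
     (\<forall>e\<in>edges G. \<forall>f\<in>edges G. e \<noteq> f \<longrightarrow> e \<inter> f \<noteq> {} \<longrightarrow> c e \<noteq> c f)"

definition has_rainbow_copy :: "'a graph \<Rightarrow> ('a set \<Rightarrow> nat) \<Rightarrow> 'b graph \<Rightarrow> bool" where
  "has_rainbow_copy G c H \<longleftrightarrow>
     (\<exists>F. subgraph F G \<and> isomorphic H F \<and> inj_on c (edges F))"

definition forces_rainbow :: "'a graph \<Rightarrow> 'b graph \<Rightarrow> bool" where
  "forces_rainbow G H \<longleftrightarrow> (\<forall>c. proper_coloring G c \<longrightarrow> has_rainbow_copy G c H)"

text \<open>Every finite graph is isomorphic to one whose vertices are natural numbers, so
  host graphs are taken on those.\<close>

definition AR_size :: "'b graph \<Rightarrow> nat" where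
  "AR_size H =
     (LEAST m. \<exists>G :: nat graph. simple_graph G \<and> card (edges G) = m \<and> forces_rainbow G H)"

definition AR_loc :: "'b graph \<Rightarrow> nat" where
  "AR_loc H = (LEAST n. forces_rainbow (complete_graph n) H)"

text \<open>A position of the game is the chronological list of the edges built so far, each
  with the color Painter gave it. The graph built consists of these edges and their
  endpoints; isolated vertices that Builder might add are not recorded, since they cannot
  take part in a copy of a graph without isolated vertices.\<close>

type_synonym position = "(nat set \<times> nat) list"

definition built_graph :: "position \<Rightarrow> nat graph" where
  "built_graph p = (\<Union> (fst ` set p), fst ` set p)"

definition color_of :: "position \<Rightarrow> nat set \<Rightarrow> nat" where
  "color_of p e = the (map_of p e)"

definition valid_position :: "position \<Rightarrow> bool" where
  "valid_position p \<longleftrightarrow>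
     distinct (map fst p) \<and> simple_graph (built_graph p) \<and>
     proper_coloring (built_graph p) (color_of p)"

definition legal_edge :: "position \<Rightarrow> nat set \<Rightarrow> bool" where
  "legal_edge p e \<longleftrightarrow> card e = 2 \<and> e \<notin> edges (built_graph p)"

type_synonym builder = "position \<Rightarrow> nat set"
type_synonym painter = "position \<Rightarrow> nat set \<Rightarrow> nat"

definition builder_strategy :: "builder \<Rightarrow> bool" where
  "builder_strategy B \<longleftrightarrow> (\<forall>p. valid_position p \<longrightarrow> legal_edge p (B p))"

definition painter_strategy :: "painter \<Rightarrow> bool" where
  "painter_strategy P \<longleftrightarrow>
     (\<forall>p e. valid_position p \<longrightarrow> legal_edge p e \<longrightarrow> valid_position (p @ [(e, P p e)]))"

fun play :: "builder \<Rightarrow> painter \<Rightarrow> nat \<Rightarrow> position" where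
  "play B P 0 = []"
| "play B P (Suc n) = (let p = play B P n; e = B p in p @ [(e, P p e)])"

definition builder_wins :: "builder \<Rightarrow> painter \<Rightarrow> nat \<Rightarrow> 'b graph \<Rightarrow> bool" where
  "builder_wins B P t H \<longleftrightarrow>
     (\<exists>k\<le>t. has_rainbow_copy (built_graph (play B P k)) (color_of (play B P k)) H)"

definition AR_online :: "'b graph \<Rightarrow> nat" where
  "AR_online H =
     (LEAST t. \<exists>B. builder_strategy B \<and> (\<forall>P. painter_strategy P \<longrightarrow> builder_wins B P t H))"

definition first_fit :: painter where
  "first_fit p e =
     (LEAST k. 1 \<le> k \<and> (\<forall>f\<in>edges (built_graph p). f \<inter> e \<noteq> {} \<longrightarrow> color_of p f \<noteq> k))"

definition AR_first_fit :: "'b graph \<Rightarrow> nat" where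
  "AR_first_fit H = (LEAST t. \<exists>B. builder_strategy B \<and> builder_wins B first_fit t H)"

end

theory Submission
  imports Defs
begin

text \<open>The cubic bound is greedy: in a properly colored complete graph a rainbow clique on \<open>s\<close>
  vertices fails to extend by a vertex \<open>v\<close> only if some edge from \<open>v\<close> to the clique repeats one of
  its \<open>s choose 2\<close> colors, which rules out at most \<open>s * (s choose 2)\<close> vertices. Hence
  \<open>AR_loc H \<le> k ^ 3\<close> where \<open>k\<close> is the number of vertices of \<open>H\<close>; since \<open>H\<close> has no isolated vertices,
  \<open>k\<close> is at most twice its number of edges, all of which Builder has to build.

  For the bound by the minimum degree, an edge at a vertex of degree less than
  \<open>min_degree H\<close> lies in no copy of \<open>H\<close>, so a host graph with the fewest edges has no such edge; and
  its non-isolated vertices span a complete graph that is a host as well.\<close>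

section \<open>Invariants of isomorphic copies, and incidence counts\<close>

section \<open>Copies\<close>

lemma simple_graph_finite_edges:
  assumes "simple_graph G"
  shows "finite (edges G)"
proof (rule finite_subset)
  show "edges G \<subseteq> Pow (verts G)"
    using assms by (auto simp: simple_graph_def)
  show "finite (Pow (verts G))"
    using assms by (simp add: simple_graph_def)
qed

lemma simple_graph_Union_edges: "simple_graph G \<Longrightarrow> \<Union> (edges G) \<subseteq> verts G"
  by (auto simp: simple_graph_def)

lemma simple_graph_inj_on_image:
  assumes "simple_graph H" "inj_on f (verts H)"
  shows "inj_on (image f) (edges H)"
  by (rule inj_on_subset[OF inj_on_image_Pow[OF assms(2)]])
    (use assms(1) in \<open>auto simp: simple_graph_def\<close>)

lemma isomorphic_card_edges:
  assumes "simple_graph H" "isomorphic H F"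
  shows "card (edges F) = card (edges H)"
proof -
  obtain f where f: "bij_betw f (verts H) (verts F)" "edges F = image f ` edges H"
    using assms(2) by (auto simp: isomorphic_def)
  show ?thesis
    using f(2) card_image[OF simple_graph_inj_on_image[OF assms(1) bij_betw_imp_inj_on[OF f(1)]]]
    by simp
qed

text \<open>An isomorphism carries an edge at \<open>u\<close> to an edge at \<open>f u\<close>, so
  a copy of \<open>H\<close> has no isolated vertices either. This lets copies be moved between host
  graphs that agree only on their edges.\<close>

lemma isomorphic_verts_subset:
  assumes "no_isolated_vertices H" "isomorphic H F"
  shows "verts F \<subseteq> \<Union> (edges F)"
proof
  fix v assume "v \<in> verts F"
  obtain f where f: "bij_betw f (verts H) (verts F)" "edges F = image f ` edges H"
    using assms(2) by (auto simp: isomorphic_def)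
  then obtain u where "u \<in> verts H" "v = f u"
    using \<open>v \<in> verts F\<close> by (metis bij_betw_imp_surj_on imageE)
  moreover obtain e where "e \<in> edges H" "u \<in> e"
    using assms(1) \<open>u \<in> verts H\<close> by (auto simp: no_isolated_vertices_def)
  ultimately show "v \<in> \<Union> (edges F)"
    using f(2) by auto
qed

text \<open>The isomorphism maps the edges at \<open>u\<close> bijectively onto the edges at
  \<open>f u\<close>, so degrees are preserved. It serves to keep vertices of small degree out of
  every copy of \<open>H\<close>.\<close>

lemma isomorphic_min_degree_le:
  assumes "simple_graph H" "isomorphic H F" "v \<in> verts F"
  shows "min_degree H \<le> degree F v"
proof -
  obtain f where f: "bij_betw f (verts H) (verts F)" "edges F = image f ` edges H"
    using assms(2) by (auto simp: isomorphic_def)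
  then obtain u where u: "u \<in> verts H" "v = f u"
    using assms(3) by (metis bij_betw_imp_surj_on imageE)
  have inj: "inj_on f (verts H)"
    using f(1) by (rule bij_betw_imp_inj_on)
  have mem: "f u \<in> f ` e \<longleftrightarrow> u \<in> e" if "e \<in> edges H" for e
    by (rule inj_on_image_mem_iff[OF inj u(1)])
      (use assms(1) that in \<open>auto simp: simple_graph_def\<close>)
  have "{e \<in> edges F. v \<in> e} = image f ` {e \<in> edges H. u \<in> e}"
    using mem by (auto simp: f(2) u(2))
  moreover have "inj_on (image f) {e \<in> edges H. u \<in> e}"
    by (rule inj_on_subset[OF simple_graph_inj_on_image[OF assms(1) inj]]) auto
  ultimately have "degree F v = degree H u"
    by (simp add: degree_def card_image)
  moreover have "min_degree H \<le> degree H u"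
    unfolding min_degree_def
    by (rule Min_le) (use assms(1) u(1) in \<open>auto simp: simple_graph_def\<close>)
  ultimately show ?thesis by simp
qed

text \<open>The edges cover all vertices, and each of them covers only two.\<close>

lemma card_verts_le_twice_card_edges:
  assumes "simple_graph H" "no_isolated_vertices H"
  shows "card (verts H) \<le> 2 * card (edges H)"
proof -
  have "verts H = \<Union> (edges H)"
    using assms by (auto simp: simple_graph_def no_isolated_vertices_def)
  also have "card (\<Union> (edges H)) \<le> (\<Sum>e\<in>edges H. card e)"
    by (rule card_Union_le_sum_card)
  also have "\<dots> = (\<Sum>e\<in>edges H. 2)"
    by (rule sum.cong) (use assms(1) in \<open>auto simp: simple_graph_def\<close>)
  finally show ?thesis by simp
qed

text \<open>Double counting of incident pairs. The sum runs over the non-isolated vertices only,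
  since their number is the order of the complete graph that is compared with \<open>G\<close>
  later.\<close>

lemma degree_sum:
  assumes "simple_graph G"
  shows "(\<Sum>v\<in>\<Union> (edges G). degree G v) = 2 * card (edges G)"
proof -
  have fin: "finite (\<Union> (edges G))" "finite (edges G)"
    using assms simple_graph_Union_edges[OF assms] simple_graph_finite_edges[OF assms]
    by (auto simp: simple_graph_def intro: finite_subset)
  have "(\<Sum>v\<in>\<Union> (edges G). degree G v) = (\<Sum>v\<in>\<Union> (edges G). \<Sum>e | e \<in> edges G \<and> v \<in> e. 1)"
    by (simp add: degree_def)
  also have "\<dots> = (\<Sum>e\<in>edges G. \<Sum>v | v \<in> \<Union> (edges G) \<and> v \<in> e. 1)"
    by (rule sum.swap_restrict[OF fin])
  also have "\<dots> = (\<Sum>e\<in>edges G. 2)"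
  proof (rule sum.cong)
    fix e assume "e \<in> edges G"
    then have "{v. v \<in> \<Union> (edges G) \<and> v \<in> e} = e" "card e = 2"
      using assms by (auto simp: simple_graph_def)
    then show "(\<Sum>v | v \<in> \<Union> (edges G) \<and> v \<in> e. 1) = (2::nat)" by simp
  qed simp
  finally show ?thesis by simp
qed

section \<open>Greedy rainbow cliques and the existence of complete hosts\<close>

section \<open>Complete graphs\<close>

lemma simple_graph_complete_graph: "simple_graph (complete_graph n)"
  by (auto simp: simple_graph_def complete_graph_def)

lemma card_edges_complete_graph: "card (edges (complete_graph n)) = n choose 2"
  by (simp add: complete_graph_def n_subsets)

text \<open>Adding a vertex to a clique adds exactly the star at that vertex; the greedy step treats
  the two kinds of edges separately.\<close>

lemma pairs_insert:
  assumes "v \<notin> S"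
  shows "{e. e \<subseteq> insert v S \<and> card e = 2} = {e. e \<subseteq> S \<and> card e = 2} \<union> (\<lambda>a. {v, a}) ` S"
    (is "?L = ?R")
proof
  show "?L \<subseteq> ?R"
  proof
    fix e assume "e \<in> ?L"
    then have e: "e \<subseteq> insert v S" "card e = 2" by auto
    then obtain x y where "e = {x, y}" "x \<noteq> y" by (auto simp: card_2_iff)
    then show "e \<in> ?R"
      using e by (cases "v = x"; cases "v = y") (auto simp: insert_commute)
  qed
  show "?R \<subseteq> ?L"
    using assms by (auto simp: card_insert_if card_2_iff)
qed

lemma proper_coloring_complete_graph_neq:
  assumes "proper_coloring (complete_graph N) c" "a < N" "v < N" "w < N"
    and "v \<noteq> a" "w \<noteq> a" "v \<noteq> w"
  shows "c {v, a} \<noteq> c {w, a}"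
  using assms
  by (auto simp: proper_coloring_def complete_graph_def card_insert_if doubleton_eq_iff)

lemma rainbow_clique:
  assumes c: "proper_coloring (complete_graph (k ^ 3)) c" and "s \<le> k"
  shows "\<exists>S\<subseteq>{..<k ^ 3}. card S = s \<and> inj_on c {e. e \<subseteq> S \<and> card e = 2}"
  using \<open>s \<le> k\<close>
proof (induction s)
  case 0
  show ?case
    by (rule exI[of _ "{}"]) (auto simp: inj_on_def)
next
  case (Suc s)
  let ?V = "{..<k ^ 3}"
  obtain S where S: "S \<subseteq> ?V" "card S = s" and inj: "inj_on c {e. e \<subseteq> S \<and> card e = 2}"
    using Suc by auto
  let ?P = "{e. e \<subseteq> S \<and> card e = 2}"
  have finS: "finite S" using S(1) finite_subset by blast
  \<comment> \<open>For \<open>a\<close> in \<open>S\<close> and a clique edge \<open>e\<close>,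
    this set holds the vertices whose edge to \<open>a\<close> repeats the color of
    \<open>e\<close>. A vertex outside \<open>S\<close> and outside all these sets can extend the
    clique.\<close>
  define B where "B = (\<lambda>(a, e). {v \<in> ?V. v \<noteq> a \<and> c {v, a} = c e})"
  \<comment> \<open>Two members would send equally colored edges to the common endpoint
    \<open>a\<close>, against properness.\<close>
  have "card (B x) \<le> 1" if x: "x \<in> S \<times> ?P" for x
  proof -
    obtain a e where [simp]: "x = (a, e)" by fastforce
    have "v = w" if "v \<in> B x" "w \<in> B x" for v w
    proof (rule ccontr)
      assume "v \<noteq> w"
      moreover have "a < k ^ 3" using x S(1) by auto
      ultimately show False
        using that proper_coloring_complete_graph_neq[OF c, of a v w] by (auto simp: B_def)
    qed
    moreover have "finite (B x)" by (auto simp: B_def split: prod.splits)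
    ultimately show ?thesis by (auto simp: card_le_Suc0_iff_eq)
  qed
  then have "card (\<Union> (B ` (S \<times> ?P))) \<le> (\<Sum>x\<in>S \<times> ?P. 1)"
    using finS by (intro order_trans[OF card_UN_le] sum_mono) auto
  also have "\<dots> = s * (s choose 2)"
    using finS S(2) by (simp add: n_subsets)
  also have "\<dots> \<le> s * (s * s)"
    by (intro mult_le_mono2) (simp add: choose_two order_trans[OF div_le_dividend])
  finally have "card (S \<union> \<Union> (B ` (S \<times> ?P))) \<le> s + s * (s * s)"
    using card_Un_le[of S "\<Union> (B ` (S \<times> ?P))"] S(2) by linarith
  \<comment> \<open>The difference of the two sides is \<open>3 * s^2 + 2 * s + 1\<close>, so the
    crude bound \<open>s * s\<close> for the number of pairs is affordable.\<close>
  also have "\<dots> < Suc s ^ 3"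
    by (simp add: power3_eq_cube algebra_simps)
  also have "\<dots> \<le> card ?V"
    using Suc.prems by (simp add: power_mono)
  finally have less: "card (S \<union> \<Union> (B ` (S \<times> ?P))) < card ?V" .
  have "finite (B x)" for x
    by (auto simp: B_def split: prod.splits)
  then have "finite (S \<union> \<Union> (B ` (S \<times> ?P)))"
    using finS by auto
  then have "\<not> ?V \<subseteq> S \<union> \<Union> (B ` (S \<times> ?P))"
    using less card_mono by (metis not_le)
  then obtain v where v: "v \<in> ?V" "v \<notin> S" "\<And>x. x \<in> S \<times> ?P \<Longrightarrow> v \<notin> B x"
    by blast
  have fresh: "c {v, a} \<noteq> c e" if "a \<in> S" "e \<in> ?P" for a e
    using v(1,2) v(3)[of "(a, e)"] that by (auto simp: B_def)
  define E where "E = (\<lambda>a. {v, a}) ` S"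
  have "inj_on c E"
  proof (rule inj_onI)
    fix e f assume "e \<in> E" "f \<in> E" and eq: "c e = c f"
    then obtain a b where ab: "a \<in> S" "b \<in> S" "e = {v, a}" "f = {v, b}"
      by (auto simp: E_def)
    then have "a < k ^ 3" "b < k ^ 3" "a \<noteq> v" "b \<noteq> v" "c {a, v} = c {b, v}"
      using eq v(2) S(1) by (auto simp: insert_commute[of a] insert_commute[of b])
    then have "a = b"
      using proper_coloring_complete_graph_neq[OF c, of v a b] v(1) by auto
    then show "e = f" using ab by simp
  qed
  \<comment> \<open>The old clique and the new star share no color at all, which implies the
    condition on differences in \<open>inj_on_Un\<close>.\<close>
  moreover have "c ` (?P - E) \<inter> c ` (E - ?P) = {}"
  proof -
    have "c f \<noteq> c e" if "f \<in> E" "e \<in> ?P" for e f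
      using that(1) fresh[OF _ that(2)] by (auto simp: E_def)
    then have "c ` ?P \<inter> c ` E = {}" by (simp add: disjoint_iff image_iff) metis
    moreover have "c ` (?P - E) \<inter> c ` (E - ?P) \<subseteq> c ` ?P \<inter> c ` E"
      by (intro Int_mono image_mono Diff_subset)
    ultimately show ?thesis by (simp only: subset_empty)
  qed
  ultimately have "inj_on c (?P \<union> E)"
    using inj by (simp only: inj_on_Un)
  then have "inj_on c {e. e \<subseteq> insert v S \<and> card e = 2}"
    by (simp add: pairs_insert[OF v(2)] E_def)
  moreover have "card (insert v S) = Suc s" "insert v S \<subseteq> ?V"
    using finS v(1,2) S by auto
  ultimately show ?case by blast
qed

text \<open>Any bijection from the vertices of \<open>H\<close> onto a rainbow clique of the same
  size yields a rainbow copy. This also guarantees that the minimum defining \<open>AR_loc\<close>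
  is attained.\<close>

lemma complete_graph_forces_rainbow:
  assumes H: "simple_graph H"
  shows "forces_rainbow (complete_graph (card (verts H) ^ 3)) H"
  unfolding forces_rainbow_def
proof (intro allI impI)
  let ?K = "complete_graph (card (verts H) ^ 3)"
  fix c assume "proper_coloring ?K c"
  then obtain S where S: "S \<subseteq> {..<card (verts H) ^ 3}" "card S = card (verts H)"
    and inj: "inj_on c {e. e \<subseteq> S \<and> card e = 2}"
    using rainbow_clique by blast
  have "finite S" using S(1) finite_subset by blast
  then obtain f where f: "bij_betw f (verts H) S"
    using S(2) H finite_same_card_bij[of "verts H" S] by (auto simp: simple_graph_def)
  have E: "f ` e \<subseteq> S \<and> card (f ` e) = 2" if "e \<in> edges H" for e
  proof -
    have "e \<subseteq> verts H" "card e = 2" using H that by (auto simp: simple_graph_def)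
    then show ?thesis
      using f card_image[of f e] by (auto simp: bij_betw_def inj_on_subset)
  qed
  let ?F = "(S, image f ` edges H)"
  have "subgraph ?F ?K"
    using E S(1) \<open>finite S\<close> by (fastforce simp: subgraph_def simple_graph_def complete_graph_def)
  moreover have "isomorphic H ?F"
    using f by (auto simp: isomorphic_def)
  moreover have "inj_on c (edges ?F)"
    by (rule inj_on_subset[OF inj]) (use E in auto)
  ultimately show "has_rainbow_copy ?K c H"
    by (auto simp: has_rainbow_copy_def)
qed

lemma AR_loc_forces_rainbow:
  "simple_graph H \<Longrightarrow> forces_rainbow (complete_graph (AR_loc H)) H"
  unfolding AR_loc_def by (rule LeastI) (rule complete_graph_forces_rainbow)

lemma AR_loc_le: "forces_rainbow (complete_graph n) H \<Longrightarrow> AR_loc H \<le> n"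
  unfolding AR_loc_def by (rule Least_le)

section \<open>Hosts with the fewest edges and their minimum degree\<close>

section \<open>The size anti-Ramsey number\<close>

lemma AR_size_le:
  fixes G :: "nat graph"
  shows "simple_graph G \<Longrightarrow> forces_rainbow G H \<Longrightarrow> AR_size H \<le> card (edges G)"
  unfolding AR_size_def by (rule Least_le) blast

text \<open>A complete graph is a host, so the \<open>LEAST\<close> ranges over a nonempty
  set.\<close>

lemma AR_size_attained:
  assumes "simple_graph H"
  obtains G :: "nat graph" where
    "simple_graph G" "card (edges G) = AR_size H" "forces_rainbow G H"
proof -
  have "\<exists>m. \<exists>G :: nat graph. simple_graph G \<and> card (edges G) = m \<and> forces_rainbow G H"
    using simple_graph_complete_graph AR_loc_forces_rainbow[OF assms] by blast
  from LeastI_ex[OF this] show ?thesis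
    using that unfolding AR_size_def by blast
qed

lemma AR_size_le_choose:
  assumes "simple_graph H"
  shows "AR_size H \<le> AR_loc H choose 2"
  using AR_size_le[OF simple_graph_complete_graph AR_loc_forces_rainbow[OF assms]]
  by (simp add: card_edges_complete_graph)

lemma proper_coloring_mono:
  "proper_coloring G c \<Longrightarrow> edges F \<subseteq> edges G \<Longrightarrow> proper_coloring F c"
  unfolding proper_coloring_def by blast

text \<open>A proper coloring of the smaller graph extends to \<open>G\<close> by giving
  \<open>e\<close> a fresh color. The rainbow copy found in \<open>G\<close> cannot contain
  \<open>v\<close>, whose degree is too small, so it avoids \<open>e\<close> and keeps its original
  colors.\<close>

lemma forces_rainbow_delete_edge:
  assumes G: "simple_graph G" "forces_rainbow G H" and H: "simple_graph H"
    and e: "e \<in> edges G" "v \<in> e" "degree G v < min_degree H"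
  shows "forces_rainbow (verts G, edges G - {e}) H"
  unfolding forces_rainbow_def
proof (intro allI impI)
  let ?G = "(verts G, edges G - {e})"
  fix c assume c: "proper_coloring ?G c"
  have fin: "finite (edges G)" using G(1) by (rule simple_graph_finite_edges)
  \<comment> \<open>The successor of the maximum exceeds every value of \<open>c\<close> on
    \<open>G\<close> and is positive, as a color must be.\<close>
  define d where "d = c(e := Suc (Max (insert 0 (c ` edges G))))"
  have less: "c f < d e" if "f \<in> edges G" for f
    using that fin by (auto simp: d_def less_Suc_eq_le intro: Max_ge)
  have "proper_coloring G d"
    unfolding proper_coloring_def
  proof (intro conjI ballI impI)
    fix f assume "f \<in> edges G"
    then show "1 \<le> d f" using c by (auto simp: d_def proper_coloring_def)
  next
    fix f g assume "f \<in> edges G" "g \<in> edges G" "f \<noteq> g" "f \<inter> g \<noteq> {}"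
    moreover have "d f = c f" if "f \<noteq> e" for f using that by (simp add: d_def)
    ultimately show "d f \<noteq> d g"
      using c less[of f] less[of g]
      by (cases "f = e"; cases "g = e") (auto simp: proper_coloring_def)
  qed
  then obtain F where F: "subgraph F G" "isomorphic H F" "inj_on d (edges F)"
    using G(2) by (auto simp: forces_rainbow_def has_rainbow_copy_def)
  have "e \<notin> edges F"
  proof
    assume "e \<in> edges F"
    then have "v \<in> verts F" using F(1) e(2) by (auto simp: subgraph_def simple_graph_def)
    then have "min_degree H \<le> degree F v"
      by (rule isomorphic_min_degree_le[OF H F(2)])
    also have "\<dots> \<le> degree G v"
      unfolding degree_def by (rule card_mono) (use fin F(1) in \<open>auto simp: subgraph_def\<close>)
    finally show False using e(3) by simp
  qed
  then have "subgraph F ?G" using F(1) by (auto simp: subgraph_def)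
  moreover have "inj_on c (edges F)"
    using F(3) \<open>e \<notin> edges F\<close> by (metis d_def fun_upd_other inj_on_cong)
  ultimately show "has_rainbow_copy ?G c H"
    using F(2) unfolding has_rainbow_copy_def by blast
qed

text \<open>A bijection \<open>h\<close> from the non-isolated vertices onto an initial segment
  embeds the edges of \<open>G\<close> in the complete graph. A coloring of the latter is pulled
  back along \<open>h\<close>, and the rainbow copy obtained in \<open>G\<close> is pushed
  forward.\<close>

lemma forces_rainbow_complete_graph_card:
  fixes G :: "nat graph"
  assumes G: "simple_graph G" "forces_rainbow G H" and H: "no_isolated_vertices H"
  shows "forces_rainbow (complete_graph (card (\<Union> (edges G)))) H"
  unfolding forces_rainbow_def
proof (intro allI impI)
  let ?K = "complete_graph (card (\<Union> (edges G)))"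
  fix c assume c: "proper_coloring ?K c"
  have "finite (\<Union> (edges G))"
    using G(1) by (intro finite_subset[OF simple_graph_Union_edges]) (auto simp: simple_graph_def)
  then obtain h where h: "bij_betw h (\<Union> (edges G)) {..<card (\<Union> (edges G))}"
    using finite_same_card_bij by (metis card_lessThan finite_lessThan)
  have inj: "inj_on h (\<Union> (edges G))" using h by (rule bij_betw_imp_inj_on)
  have inj_im: "inj_on (image h) (edges G)"
    by (rule inj_on_subset[OF inj_on_image_Pow[OF inj]]) auto
  have im: "h ` e \<in> edges ?K" if "e \<in> edges G" for e
  proof -
    have "e \<subseteq> \<Union> (edges G)" "card e = 2" using G(1) that by (auto simp: simple_graph_def)
    moreover from this have "card (h ` e) = 2" using inj by (metis card_image inj_on_subset)
    ultimately show ?thesis using h by (auto simp: complete_graph_def bij_betw_def)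
  qed
  have "proper_coloring G (c \<circ> image h)"
    unfolding proper_coloring_def
  proof (intro conjI ballI impI)
    fix e assume "e \<in> edges G"
    then show "1 \<le> (c \<circ> image h) e" using im c by (auto simp: proper_coloring_def)
  next
    fix e f assume ef: "e \<in> edges G" "f \<in> edges G" "e \<noteq> f" "e \<inter> f \<noteq> {}"
    then have "h ` e \<noteq> h ` f" "h ` e \<inter> h ` f \<noteq> {}"
      using inj_im by (auto dest: inj_onD)
    then show "(c \<circ> image h) e \<noteq> (c \<circ> image h) f"
      using im ef(1,2) c by (auto simp: proper_coloring_def)
  qed
  then obtain F where F: "subgraph F G" "isomorphic H F" "inj_on (c \<circ> image h) (edges F)"
    using G(2) by (auto simp: forces_rainbow_def has_rainbow_copy_def)
  have FG: "edges F \<subseteq> edges G" and sF: "simple_graph F" using F(1) by (auto simp: subgraph_def)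
  \<comment> \<open>\<open>h\<close> is injective only on non-isolated vertices of \<open>G\<close>,
    so the copy must be seen to live there.\<close>
  have vF: "verts F \<subseteq> \<Union> (edges G)"
    using isomorphic_verts_subset[OF H F(2)] FG by auto
  let ?F = "(h ` verts F, image h ` edges F)"
  obtain f where f: "bij_betw f (verts H) (verts F)" "edges F = image f ` edges H"
    using F(2) by (auto simp: isomorphic_def)
  have "bij_betw (h \<circ> f) (verts H) (verts ?F)"
    using f(1) inj_on_subset[OF inj vF] by (auto intro: bij_betw_trans inj_on_imp_bij_betw)
  then have "isomorphic H ?F"
    unfolding isomorphic_def using f(2) by (intro exI[of _ "h \<circ> f"]) (auto simp: image_comp)
  moreover have "subgraph ?F ?K"
  proof -
    have "h ` e \<subseteq> h ` verts F \<and> card (h ` e) = 2 \<and> h ` e \<in> edges ?K" if "e \<in> edges F" for e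
    proof -
      have "e \<subseteq> verts F" using sF that by (simp add: simple_graph_def)
      moreover have "h ` e \<in> edges ?K" using FG im that by blast
      ultimately show ?thesis by (auto simp: complete_graph_def)
    qed
    moreover have "h ` verts F \<subseteq> verts ?K"
      using h vF by (auto simp: bij_betw_def complete_graph_def)
    ultimately show ?thesis
      using sF by (auto simp: subgraph_def simple_graph_def)
  qed
  moreover have "inj_on c (edges ?F)"
    using F(3) by (simp add: inj_on_imageI)
  ultimately show "has_rainbow_copy ?K c H"
    by (auto simp: has_rainbow_copy_def)
qed

text \<open>Let m be the number of non-isolated vertices of a host with the fewest edges. The
  complete graph on m vertices is a host, so m is at least \<open>AR_loc H\<close>; each of the m
  degrees is at least \<open>min_degree H\<close>, and they sum to
  \<open>2 * AR_size H\<close>.\<close>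

lemma AR_loc_mult_min_degree_le:
  assumes H: "simple_graph H" "no_isolated_vertices H"
  shows "AR_loc H * min_degree H \<le> 2 * AR_size H"
proof -
  obtain G :: "nat graph" where
    G: "simple_graph G" "card (edges G) = AR_size H" "forces_rainbow G H"
    using AR_size_attained[OF H(1)] .
  have deg: "min_degree H \<le> degree G v" if v: "v \<in> \<Union> (edges G)" for v
  proof (rule ccontr)
    assume less: "\<not> min_degree H \<le> degree G v"
    obtain e where e: "e \<in> edges G" "v \<in> e" using v by auto
    have "AR_size H \<le> card (edges (verts G, edges G - {e}))"
      by (rule AR_size_le)
        (use G(1) less e forces_rainbow_delete_edge[OF G(1,3) H(1) e]
          in \<open>auto simp: simple_graph_def\<close>)
    moreover have "card (edges G - {e}) < card (edges G)"
      by (rule card_Diff1_less[OF simple_graph_finite_edges[OF G(1)] e(1)])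
    ultimately show False using G(2) by simp
  qed
  have "AR_loc H * min_degree H \<le> card (\<Union> (edges G)) * min_degree H"
    by (intro mult_le_mono1 AR_loc_le forces_rainbow_complete_graph_card[OF G(1,3) H(2)])
  also have "\<dots> \<le> (\<Sum>v\<in>\<Union> (edges G). degree G v)"
    using sum_bounded_below[of "\<Union> (edges G)" "min_degree H" "degree G"] deg by simp
  also have "\<dots> = 2 * AR_size H"
    using degree_sum[OF G(1)] G(2) by simp
  finally show ?thesis .
qed

section \<open>Positions, strategies and the comparison of the online, First-Fit and size
  numbers\<close>

section \<open>The online game\<close>

lemma edges_built_graph: "edges (built_graph p) = fst ` set p"
  by (simp add: built_graph_def)

lemma finite_edges_built_graph: "finite (edges (built_graph p))"
  by (simp add: edges_built_graph)

lemma valid_position_Nil: "valid_position []"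
  by (simp add: valid_position_def built_graph_def simple_graph_def proper_coloring_def)

text \<open>Infinitely many pairs contain 0 and only finitely many edges are built. Builder thus
  always has a move, even after a planned graph is complete.\<close>

lemma ex_legal_edge: "\<exists>e. legal_edge p e"
proof -
  have "inj (\<lambda>n. {0, Suc n})" by (auto simp: inj_def doubleton_eq_iff)
  then have "infinite (range (\<lambda>n. {0, Suc n}))" using finite_imageD infinite_UNIV_nat by blast
  then obtain n where "{0, Suc n} \<notin> edges (built_graph p)"
    using finite_edges_built_graph[of p] by (metis finite_subset image_subsetI)
  then have "legal_edge p {0, Suc n}" by (simp add: legal_edge_def)
  then show ?thesis ..
qed

text \<open>\<open>map_of\<close> returns the first match while moves are appended at the end; as
  \<open>e\<close> is new, no earlier entry shadows its color.\<close>

lemma color_of_snoc: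
  "e \<notin> edges (built_graph p) \<Longrightarrow>
    color_of (p @ [(e, k)]) f = (if f = e then k else color_of p f)"
  using map_of_eq_None_iff[of p e]
  by (cases "map_of p f") (auto simp: color_of_def edges_built_graph map_add_def)

lemma valid_position_snoc:
  assumes p: "valid_position p" and e: "legal_edge p e" and "1 \<le> k"
    and k: "\<And>f. f \<in> edges (built_graph p) \<Longrightarrow> f \<inter> e \<noteq> {} \<Longrightarrow> color_of p f \<noteq> k"
  shows "valid_position (p @ [(e, k)])"
proof -
  let ?q = "p @ [(e, k)]"
  have new: "e \<notin> edges (built_graph p)" "card e = 2" using e by (auto simp: legal_edge_def)
  have q: "edges (built_graph ?q) = insert e (edges (built_graph p))"
    by (simp add: edges_built_graph)
  have "finite e" using new(2) card.infinite by fastforce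
  then have "simple_graph (built_graph ?q)"
    using p new(2) by (auto simp: valid_position_def simple_graph_def built_graph_def)
  moreover have "distinct (map fst ?q)"
    using p new(1) by (auto simp: valid_position_def edges_built_graph)
  moreover have "proper_coloring (built_graph ?q) (color_of ?q)"
    unfolding proper_coloring_def
  proof (intro conjI ballI impI)
    fix f assume "f \<in> edges (built_graph ?q)"
    then show "1 \<le> color_of ?q f"
      using p \<open>1 \<le> k\<close> new(1) by (auto simp: q color_of_snoc valid_position_def proper_coloring_def)
  next
    fix f g
    assume "f \<in> edges (built_graph ?q)" "g \<in> edges (built_graph ?q)" "f \<noteq> g" "f \<inter> g \<noteq> {}"
    then show "color_of ?q f \<noteq> color_of ?q g"
      using p new(1) k[of f] k[of g]
      by (cases "f = e"; cases "g = e")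
        (auto simp: q color_of_snoc valid_position_def proper_coloring_def Int_commute)
  qed
  ultimately show ?thesis by (simp add: valid_position_def)
qed

text \<open>Only finitely many colors are in use, so the \<open>LEAST\<close> in
  \<open>first_fit\<close> is attained and satisfies its own condition.\<close>

lemma painter_strategy_first_fit: "painter_strategy first_fit"
  unfolding painter_strategy_def
proof (intro allI impI)
  fix p e assume p: "valid_position p" "legal_edge p e"
  let ?Q = "\<lambda>k. 1 \<le> k \<and> (\<forall>f\<in>edges (built_graph p). f \<inter> e \<noteq> {} \<longrightarrow> color_of p f \<noteq> k)"
  have "finite (insert 0 (color_of p ` edges (built_graph p)))"
    using finite_edges_built_graph by simp
  \<comment> \<open>Excluding 0 together with the used colors makes \<open>k\<close> a legitimate
    color.\<close>
  then obtain k where "k \<notin> insert 0 (color_of p ` edges (built_graph p))"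
    using ex_new_if_finite infinite_UNIV_nat by blast
  then have "?Q k" by auto
  then have "?Q (first_fit p e)"
    unfolding first_fit_def by (rule LeastI)
  then show "valid_position (p @ [(e, first_fit p e)])"
    using p by (intro valid_position_snoc) auto
qed

lemma valid_position_play:
  assumes "builder_strategy B" "painter_strategy P"
  shows "valid_position (play B P n)"
proof (induction n)
  case (Suc n)
  then show ?case
    using assms by (auto simp: Let_def builder_strategy_def painter_strategy_def)
qed (simp add: valid_position_Nil)

lemma length_play: "length (play B P n) = n"
  by (induction n) (auto simp: Let_def)

lemma card_edges_play_le: "card (edges (built_graph (play B P n))) \<le> n"
  using card_image_le[of "set (play B P n)" fst] card_length[of "play B P n"]
  by (simp add: edges_built_graph length_play)

text \<open>Valid positions never repeat an edge, so every move counts.\<close>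

lemma card_edges_play:
  assumes "builder_strategy B" "painter_strategy P"
  shows "card (edges (built_graph (play B P n))) = n"
proof -
  have "distinct (map fst (play B P n))"
    using valid_position_play[OF assms] by (simp add: valid_position_def)
  then show ?thesis
    using distinct_card[of "map fst (play B P n)"] by (simp add: edges_built_graph length_play)
qed

text \<open>Builder presents the edges of a fixed graph \<open>G\<close> in arbitrary order. The
  fallback to any legal edge is there because a strategy must answer every valid position, including
  those where \<open>G\<close> is exhausted.\<close>

definition build :: "nat graph \<Rightarrow> builder" where
  "build G p =
     (SOME e. legal_edge p e \<and> (edges G - edges (built_graph p) \<noteq> {} \<longrightarrow> e \<in> edges G))"

lemma build_spec:
  assumes "simple_graph G"
  shows "legal_edge p (build G p)"
    and "edges G - edges (built_graph p) \<noteq> {} \<Longrightarrow> build G p \<in> edges G"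
proof -
  have "\<exists>e. legal_edge p e \<and> (edges G - edges (built_graph p) \<noteq> {} \<longrightarrow> e \<in> edges G)"
  proof (cases "edges G - edges (built_graph p) = {}")
    case True
    then show ?thesis using ex_legal_edge by auto
  next
    case False
    then show ?thesis using assms by (auto simp: legal_edge_def simple_graph_def)
  qed
  from someI_ex[OF this] show "legal_edge p (build G p)"
    and "edges G - edges (built_graph p) \<noteq> {} \<Longrightarrow> build G p \<in> edges G"
    by (auto simp: build_def)
qed

lemma builder_strategy_build: "simple_graph G \<Longrightarrow> builder_strategy (build G)"
  by (simp add: builder_strategy_def build_spec)

text \<open>Builder stays inside \<open>G\<close> as long as edges of \<open>G\<close> are missing,
  and each move adds a new edge. After \<open>card (edges G)\<close> moves the built edges form a
  subset of full cardinality.\<close>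

lemma edges_play_build:
  assumes G: "simple_graph G" and P: "painter_strategy P"
  shows "edges (built_graph (play (build G) P (card (edges G)))) = edges G"
proof -
  note B = builder_strategy_build[OF G]
  note fin = simple_graph_finite_edges[OF G]
  have "edges (built_graph (play (build G) P n)) \<subseteq> edges G" if "n \<le> card (edges G)" for n
    using that
  proof (induction n)
    case 0
    then show ?case by (simp add: edges_built_graph)
  next
    case (Suc n)
    let ?p = "play (build G) P n"
    \<comment> \<open>Only \<open>n\<close> edges have been built, fewer than \<open>G\<close>
      has.\<close>
    have "edges (built_graph ?p) \<noteq> edges G"
      using Suc.prems card_edges_play[OF B P, of n] by auto
    then have "build G ?p \<in> edges G"
      using Suc by (intro build_spec(2)[OF G]) auto
    then show ?case using Suc by (auto simp: edges_built_graph Let_def)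
  qed
  from card_subset_eq[OF fin this[OF order_refl]] show ?thesis
    by (simp add: card_edges_play[OF B P])
qed

text \<open>The built graph has only endpoints of edges as vertices, whereas \<open>G\<close> may
  have isolated ones; a copy of \<open>H\<close> uses none of these.\<close>

lemma has_rainbow_copy_built_graph:
  assumes "no_isolated_vertices H" "has_rainbow_copy G c H" "edges (built_graph p) = edges G"
  shows "has_rainbow_copy (built_graph p) c H"
proof -
  obtain F where F: "subgraph F G" "isomorphic H F" "inj_on c (edges F)"
    using assms(2) by (auto simp: has_rainbow_copy_def)
  have "edges F \<subseteq> edges (built_graph p)"
    using F(1) assms(3) by (simp add: subgraph_def)
  moreover from this have "verts F \<subseteq> verts (built_graph p)"
    using isomorphic_verts_subset[OF assms(1) F(2)] by (fastforce simp: built_graph_def)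
  ultimately have "subgraph F (built_graph p)"
    using F(1) by (simp add: subgraph_def)
  then show ?thesis using F(2,3) unfolding has_rainbow_copy_def by blast
qed

text \<open>However Painter answers, the final coloring is a proper coloring of \<open>G\<close>,
  and every such coloring contains a rainbow copy.\<close>

lemma builder_wins_build:
  assumes H: "no_isolated_vertices H" and G: "simple_graph G" "forces_rainbow G H"
    and P: "painter_strategy P"
  shows "builder_wins (build G) P (card (edges G)) H"
proof -
  let ?p = "play (build G) P (card (edges G))"
  note E = edges_play_build[OF G(1) P]
  have "proper_coloring (built_graph ?p) (color_of ?p)"
    using valid_position_play[OF builder_strategy_build[OF G(1)] P] by (simp add: valid_position_def)
  then have "proper_coloring G (color_of ?p)"
    by (rule proper_coloring_mono) (simp add: E)
  then have "has_rainbow_copy G (color_of ?p) H"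
    using G(2) by (simp add: forces_rainbow_def)
  then show ?thesis
    using has_rainbow_copy_built_graph[OF H _ E] unfolding builder_wins_def by blast
qed

lemma AR_online_le_AR_size:
  assumes H: "simple_graph H" "no_isolated_vertices H"
  shows "AR_online H \<le> AR_size H"
proof -
  obtain G :: "nat graph" where
    "simple_graph G" "card (edges G) = AR_size H" "forces_rainbow G H"
    using AR_size_attained[OF H(1)] .
  then show ?thesis
    unfolding AR_online_def
    using builder_strategy_build builder_wins_build[OF H(2)]
    by (intro Least_le exI[of _ "build G"]) metis
qed

text \<open>Presenting any host wins in finitely many moves, so the \<open>LEAST\<close> is attained
  and an optimal Builder exists.\<close>

lemma AR_online_attained:
  assumes H: "simple_graph H" "no_isolated_vertices H"
  obtains B where "builder_strategy B"
    "\<And>P. painter_strategy P \<Longrightarrow> builder_wins B P (AR_online H) H"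
proof -
  obtain G :: "nat graph" where "simple_graph G" "forces_rainbow G H"
    using AR_size_attained[OF H(1)] by metis
  then have "\<exists>t B. builder_strategy B \<and> (\<forall>P. painter_strategy P \<longrightarrow> builder_wins B P t H)"
    using builder_strategy_build builder_wins_build[OF H(2)] by blast
  from LeastI_ex[OF this] show ?thesis
    using that unfolding AR_online_def by blast
qed

text \<open>First-Fit is one particular Painter, so an optimal online Builder also beats it in the
  same number of moves.\<close>

lemma AR_first_fit_le_AR_online:
  assumes H: "simple_graph H" "no_isolated_vertices H"
  shows "AR_first_fit H \<le> AR_online H"
  using AR_online_attained[OF H] painter_strategy_first_fit
  unfolding AR_first_fit_def by (metis (no_types, lifting) Least_le)

text \<open>All edges of the copy must have been built, and each move builds one edge.\<close>

lemma builder_wins_card_edges_le: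
  assumes "simple_graph H" "builder_wins B P t H"
  shows "card (edges H) \<le> t"
proof -
  obtain k F where F: "k \<le> t" "subgraph F (built_graph (play B P k))" "isomorphic H F"
    using assms(2) by (auto simp: builder_wins_def has_rainbow_copy_def)
  have "card (edges H) = card (edges F)"
    using isomorphic_card_edges[OF assms(1) F(3)] by simp
  also have "\<dots> \<le> card (edges (built_graph (play B P k)))"
    by (rule card_mono[OF finite_edges_built_graph]) (use F(2) in \<open>simp add: subgraph_def\<close>)
  also have "\<dots> \<le> t"
    using card_edges_play_le F(1) by (rule order_trans)
  finally show ?thesis .
qed

lemma card_edges_le_AR_first_fit:
  assumes H: "simple_graph H" "no_isolated_vertices H"
  shows "card (edges H) \<le> AR_first_fit H"
proof -
  have "\<exists>t B. builder_strategy B \<and> builder_wins B first_fit t H"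
    using AR_online_attained[OF H] painter_strategy_first_fit by metis
  from LeastI_ex[OF this] obtain B where "builder_wins B first_fit (AR_first_fit H) H"
    unfolding AR_first_fit_def by blast
  then show ?thesis by (rule builder_wins_card_edges_le[OF H(1)])
qed

lemma AR_loc_le_AR_first_fit:
  assumes H: "simple_graph H" "no_isolated_vertices H"
  shows "real (AR_loc H) powr (1/3) / 2 \<le> real (AR_first_fit H)"
proof -
  have "AR_loc H \<le> card (verts H) ^ 3"
    by (rule AR_loc_le[OF complete_graph_forces_rainbow[OF H(1)]])
  also have "\<dots> \<le> (2 * AR_first_fit H) ^ 3"
    using card_verts_le_twice_card_edges[OF H] card_edges_le_AR_first_fit[OF H]
    by (intro power_mono) auto
  finally have "real (AR_loc H) \<le> real (2 * AR_first_fit H) ^ 3"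
    by (metis of_nat_le_iff of_nat_power)
  then have "real (AR_loc H) powr (1/3) \<le> (real (2 * AR_first_fit H) ^ 3) powr (1/3)"
    by (intro powr_mono2) auto
  also have "\<dots> = real (2 * AR_first_fit H)"
  proof -
    \<comment> \<open>The exponents 3 and 1/3 multiply to 1; the base 0 is split off.\<close>
    have "(x ^ 3) powr (1/3) = x" if "x \<ge> 0" for x :: real
      using that by (cases "x = 0") (simp_all add: powr_powr flip: powr_numeral)
    from this[of "real (2 * AR_first_fit H)"] show ?thesis by linarith
  qed
  finally show ?thesis by simp
qed

theorem theorem1:
  fixes H :: "'a graph"
  assumes "simple_graph H" and "no_isolated_vertices H"
  shows "(real (AR_loc H) powr (1/3) / 2 \<le> real (AR_first_fit H)
           \<and> AR_first_fit H \<le> AR_online H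
           \<and> AR_online H \<le> AR_size H
           \<and> AR_size H \<le> AR_loc H choose 2)
         \<and> real (AR_size H) \<ge> 1/2 * real (AR_loc H) * real (min_degree H)"
  using AR_loc_le_AR_first_fit[OF assms] AR_first_fit_le_AR_online[OF assms]
    AR_online_le_AR_size[OF assms] AR_size_le_choose[OF assms(1)]
    of_nat_mono[OF AR_loc_mult_min_degree_le[OF assms], where 'a = real]
  by simp

end
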